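(* Fix $\theta$ and an alternative distribution $H$, and let $F_\tau=(1-\tau)F_0+\tau H$, $\tau\in[0,1]$. Suppose that i) (influence function) $\frac{d}{d\tau}E[g(W,\gamma(F_\tau),\theta)]=\int\phi(w,\gamma_0,\alpha_0,\theta)H(dw)$ and $E[\phi(W,\gamma_0,\alpha_0,\theta)]=0$; ii) $\int\phi(w,\gamma(F_\tau),\alpha(F_\tau),\theta)F_\tau(dw)=0$ for all $\tau\in[0,\bar\tau)$, for some $\bar\tau>0$; iii) $\int\phi(w,\gamma(F_\tau),\alpha(F_\tau),\theta)F_0(dw)$ and $\int\phi(w,\gamma(F_\tau),\alpha(F_\tau),\theta)H(dw)$ are continuous in $\tau$ at $\tau=0$. Then $\tau\mapsto E[\phi(W,\gamma(F_\tau),\alpha(F_\tau),\theta)]$ and $\tau\mapsto\bar\psi(\gamma(F_\tau),\alpha(F_\tau),\theta)$ are differentiable from the right at $\tau=0$ and $$0=\int\phi(w,\gamma_0,\alpha_0,\theta)H(dw)+\frac{d}{d\tau}E[\phi(W,\gamma(F_\tau),\alpha(F_\tau),\theta)]$$ $$=\frac{d}{d\tau}E[g(W,\gamma(F_\tau),\theta)]+\frac{d}{d\tau}E[\phi(W,\gamma(F_\tau),\alpha(F_\tau),\theta)]=\frac{d}{d\tau}\bar\psi(\gamma(F_\tau),\alpha(F_\tau),\theta).$$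
   Context: $W$ is a data observation with true distribution (CDF) $F_0$, and $E[\cdot]$ is expectation under $F_0$. $g(w,\gamma,\theta)$ is a vector of known functions of a realization $w$, an unknown function $\gamma$ and a finite dimensional parameter $\theta$; $\phi(w,\gamma,\alpha,\theta)$ is a vector of functions (of the same dimension) depending also on an additional unknown function $\alpha$. $F\mapsto\gamma(F)$ and $F\mapsto\alpha(F)$ are maps from distributions of $W$ to functions (the probability limits of estimators $\hat\gamma,\hat\alpha$ when $W$ has distribution $F$), with $\gamma_0=\gamma(F_0)$, $\alpha_0=\alpha(F_0)$; $H$ is such that $\gamma(F_\tau),\alpha(F_\tau)$ and all integrals displayed exist for small $\tau\ge0$. $\psi(w,\gamma,\alpha,\theta)=g(w,\gamma,\theta)+\phi(w,\gamma,\alpha,\theta)$ and $\bar\psi(\gamma,\alpha,\theta)=E[\psi(W,\gamma,\alpha,\theta)]$. In all expressions $d/d\tau$ denotes the derivative from the right at $\tau=0$. *)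

theory Defs
  imports "HOL-Probability.Probability"
begin

text \<open>The distribution \<open>F\<^sub>\<tau> = (1 - \<tau>) F + \<tau> H\<close>. Meaningful for \<open>\<tau> \<in> {0..1}\<close> and
  for \<open>F\<close> and \<open>H\<close> on the same \<open>\<sigma>\<close>-algebra only.\<close>

definition mixture :: "'w measure \<Rightarrow> 'w measure \<Rightarrow> real \<Rightarrow> 'w measure" where
  "mixture F H \<tau> = measure_of (space F) (sets F)
     (\<lambda>A. ennreal (1 - \<tau>) * emeasure F A + ennreal \<tau> * emeasure H A)"

lemma space_mixture [simp]: "space (mixture F H \<tau>) = space F"
  by (simp add: mixture_def)

lemma sets_mixture [simp]: "sets (mixture F H \<tau>) = sets F"
  by (simp add: mixture_def)

lemma emeasure_mixture:
  assumes "sets H = sets F" "A \<in> sets F"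
  shows "emeasure (mixture F H \<tau>) A
    = ennreal (1 - \<tau>) * emeasure F A + ennreal \<tau> * emeasure H A"
  unfolding mixture_def
proof (rule emeasure_measure_of_sigma)
  show "sigma_algebra (space F) (sets F)" ..
  show "positive (sets F) (\<lambda>A. ennreal (1 - \<tau>) * emeasure F A + ennreal \<tau> * emeasure H A)"
    by (simp add: positive_def)
  show "countably_additive (sets F)
      (\<lambda>A. ennreal (1 - \<tau>) * emeasure F A + ennreal \<tau> * emeasure H A)"
  proof (rule countably_additiveI)
    fix A :: "nat \<Rightarrow> 'a set"
    assume A: "range A \<subseteq> sets F" "disjoint_family A"
    then have "range A \<subseteq> sets H" using assms(1) by simp
    with A show "(\<Sum>i. ennreal (1 - \<tau>) * emeasure F (A i) + ennreal \<tau> * emeasure H (A i))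
        = ennreal (1 - \<tau>) * emeasure F (\<Union>i. A i) + ennreal \<tau> * emeasure H (\<Union>i. A i)"
      by (simp add: suminf_add [symmetric] suminf_emeasure)
  qed
qed (fact assms(2))

lemma prob_space_mixture:
  assumes "prob_space F" "prob_space H" "sets H = sets F" "0 \<le> \<tau>" "\<tau> \<le> 1"
  shows "prob_space (mixture F H \<tau>)"
proof
  have "emeasure H (space F) = 1"
    using prob_space.emeasure_space_1 [OF assms(2)] sets_eq_imp_space_eq [OF assms(3)] by simp
  then show "emeasure (mixture F H \<tau>) (space (mixture F H \<tau>)) = 1"
    using assms by (simp add: emeasure_mixture prob_space.emeasure_space_1
        ennreal_plus [symmetric] del: ennreal_plus)
qed

lemma mixture_0: "sets H = sets F \<Longrightarrow> mixture F H 0 = F"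
  by (rule measure_eqI) (simp_all add: emeasure_mixture)

definition psi ::
  "('w \<Rightarrow> 'g \<Rightarrow> 't \<Rightarrow> 'v) \<Rightarrow> ('w \<Rightarrow> 'g \<Rightarrow> 'a \<Rightarrow> 't \<Rightarrow> 'v) \<Rightarrow> 'w \<Rightarrow> 'g \<Rightarrow> 'a \<Rightarrow> 't \<Rightarrow> 'v::plus" where
  "psi g \<phi> w \<gamma> \<alpha> \<theta> = g w \<gamma> \<theta> + \<phi> w \<gamma> \<alpha> \<theta>"

definition psi_bar ::
  "'w measure \<Rightarrow> ('w \<Rightarrow> 'g \<Rightarrow> 't \<Rightarrow> 'v) \<Rightarrow> ('w \<Rightarrow> 'g \<Rightarrow> 'a \<Rightarrow> 't \<Rightarrow> 'v) \<Rightarrow> 'g \<Rightarrow> 'a \<Rightarrow> 't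
     \<Rightarrow> 'v::{banach, second_countable_topology}" where
  "psi_bar F\<^sub>0 g \<phi> \<gamma> \<alpha> \<theta> = (LINT w|F\<^sub>0. psi g \<phi> w \<gamma> \<alpha> \<theta>)"

abbreviation right_deriv_0 :: "(real \<Rightarrow> 'v::real_normed_vector) \<Rightarrow> 'v" where
  "right_deriv_0 f \<equiv> vector_derivative f (at_right 0)"

end

theory Submission
  imports Defs
begin

text \<open>Write \<open>P \<tau>\<close> and \<open>Q \<tau>\<close> for the integrals of \<open>\<phi>\<close> at \<open>(\<gamma> (F \<tau>), \<alpha> (F \<tau>))\<close> against \<open>F\<^sub>0\<close> and \<open>H\<close>.
  Integrals are affine in the mixture, so (ii) reads \<open>(1 - \<tau>) P \<tau> + \<tau> Q \<tau> = 0\<close>. As \<open>P 0 = 0\<close>,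
  the difference quotient of \<open>P\<close> at \<open>0\<close> is \<open>P \<tau> - Q \<tau>\<close>, which tends to \<open>- Q 0\<close> by (iii).\<close>

text \<open>The identity is built into \<open>emeasure_mixture\<close> for indicators, and both
  sides are stable under scaling, sums and increasing suprema, so induction over measurable
  functions carries it to all \<open>f\<close>.\<close>

lemma nn_integral_mixture:
  assumes sets_H: "sets H = sets F" and f: "f \<in> borel_measurable F"
  shows "(\<integral>\<^sup>+w. f w \<partial>mixture F H \<tau>)
    = ennreal (1 - \<tau>) * (\<integral>\<^sup>+w. f w \<partial>F) + ennreal \<tau> * (\<integral>\<^sup>+w. f w \<partial>H)"
  using f
proof (induction rule: borel_measurable_induct)
  case (cong f g)
  have "space H = space F"
    using sets_H by (rule sets_eq_imp_space_eq)
  then have "integral\<^sup>N H f = integral\<^sup>N H g" "integral\<^sup>N F f = integral\<^sup>N F g"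
    "integral\<^sup>N (mixture F H \<tau>) f = integral\<^sup>N (mixture F H \<tau>) g"
    using cong(3) by (auto intro!: nn_integral_cong)
  then show ?case
    using cong.IH by simp
next
  case (set A)
  then show ?case
    using sets_H by (simp add: emeasure_mixture)
next
  case (mult u c)
  then have "u \<in> borel_measurable H" "u \<in> borel_measurable (mixture F H \<tau>)"
    using sets_H by (simp_all cong: measurable_cong_sets)
  with mult show ?case
    by (simp add: nn_integral_cmult distrib_left mult.left_commute)
next
  case (add u v)
  then have "u \<in> borel_measurable H" "u \<in> borel_measurable (mixture F H \<tau>)"
    "v \<in> borel_measurable H" "v \<in> borel_measurable (mixture F H \<tau>)"
    using sets_H by (simp_all cong: measurable_cong_sets)
  with add show ?case
    by (simp add: nn_integral_add distrib_left add_ac)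
next
  case (seq U)
  then have meas: "U i \<in> borel_measurable H" "U i \<in> borel_measurable (mixture F H \<tau>)" for i
    using sets_H by (simp_all cong: measurable_cong_sets)
  have inc: "incseq (\<lambda>i. integral\<^sup>N M (U i))" for M
    using seq.hyps by (auto simp: incseq_def le_fun_def intro!: nn_integral_mono)
  \<comment> \<open>Monotone convergence, for arbitrary \<open>M\<close> because it is applied to
    \<open>F\<close>, \<open>H\<close> and the mixture.\<close>
  have *: "(\<integral>\<^sup>+w. (SUP i. U i) w \<partial>M) = (SUP i. integral\<^sup>N M (U i))"
    if "\<And>i. U i \<in> borel_measurable M" for M
    using nn_integral_monotone_convergence_SUP [OF \<open>incseq U\<close> that] by (simp add: image_comp)
  have "(\<integral>\<^sup>+w. (SUP i. U i) w \<partial>mixture F H \<tau>)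
      = (SUP i. ennreal (1 - \<tau>) * integral\<^sup>N F (U i) + ennreal \<tau> * integral\<^sup>N H (U i))"
    using * [OF meas(2)] seq.IH by simp
  \<comment> \<open>The supremum splits over the sum because both sequences increase, by
    \<open>inc\<close>.\<close>
  also have "\<dots> = (SUP i. ennreal (1 - \<tau>) * integral\<^sup>N F (U i)) + (SUP i. ennreal \<tau> * integral\<^sup>N H (U i))"
    by (rule ennreal_SUP_add) (use inc in \<open>auto simp: incseq_def intro!: mult_left_mono\<close>)
  also have "\<dots> = ennreal (1 - \<tau>) * (\<integral>\<^sup>+w. (SUP i. U i) w \<partial>F) + ennreal \<tau> * (\<integral>\<^sup>+w. (SUP i. U i) w \<partial>H)"
    using * [OF meas(1)] * [of F] seq.hyps by (simp add: SUP_mult_left_ennreal)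
  finally show ?case .
qed

lemma integrable_mixture:
  fixes f :: "'w \<Rightarrow> 'v::{banach, second_countable_topology}"
  assumes "sets H = sets F" "integrable F f" "integrable H f"
  shows "integrable (mixture F H \<tau>) f"
proof (rule integrableI_bounded)
  show "f \<in> borel_measurable (mixture F H \<tau>)"
    using borel_measurable_integrable [OF assms(2)] by (simp cong: measurable_cong_sets)
  have "(\<integral>\<^sup>+w. ennreal (norm (f w)) \<partial>F) < \<infinity>" "(\<integral>\<^sup>+w. ennreal (norm (f w)) \<partial>H) < \<infinity>"
    using assms by (auto simp: integrable_iff_bounded)
  then show "(\<integral>\<^sup>+w. ennreal (norm (f w)) \<partial>mixture F H \<tau>) < \<infinity>"
    using assms by (simp add: nn_integral_mixture ennreal_mult_less_top)
qed

text \<open>A real integral is the difference of the nonnegative integrals of the positive and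
  negative parts, and \<open>ennreal\<close> truncates \<open>f\<close> and \<open>- f\<close> to
  exactly these. The bounds on \<tau> let \<open>enn2real\<close> return the weights
  unchanged.\<close>

lemma integral_mixture_real:
  fixes f :: "'w \<Rightarrow> real"
  assumes sets_H: "sets H = sets F" and f: "integrable F f" "integrable H f" and \<tau>: "0 \<le> \<tau>" "\<tau> \<le> 1"
  shows "(LINT w|mixture F H \<tau>. f w) = (1 - \<tau>) * (LINT w|F. f w) + \<tau> * (LINT w|H. f w)"
proof -
  have *: "enn2real (\<integral>\<^sup>+w. ennreal (h w) \<partial>mixture F H \<tau>)
      = (1 - \<tau>) * enn2real (\<integral>\<^sup>+w. ennreal (h w) \<partial>F) + \<tau> * enn2real (\<integral>\<^sup>+w. ennreal (h w) \<partial>H)"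
    if "integrable F h" "integrable H h" for h
  proof -
    \<comment> \<open>Finiteness makes \<open>enn2real\<close> additive here, since it sends
      infinity to 0.\<close>
    have "(\<integral>\<^sup>+w. ennreal (h w) \<partial>F) < \<infinity>" "(\<integral>\<^sup>+w. ennreal (h w) \<partial>H) < \<infinity>"
      using that by (simp_all add: real_integrable_def top.not_eq_extremum)
    then show ?thesis
      using that \<tau>
      by (simp add: nn_integral_mixture sets_H enn2real_plus enn2real_mult ennreal_mult_less_top)
  qed
  show ?thesis
    using * [OF f] * [of "\<lambda>w. - f w"] f integrable_mixture [OF sets_H f]
    by (simp add: real_lebesgue_integral_def algebra_simps)
qed

text \<open>Integration commutes with the inner product against a basis vector, so the real case
  applies to each coordinate.\<close>

lemma integral_mixture:
  fixes f :: "'w \<Rightarrow> 'v::euclidean_space"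
  assumes "sets H = sets F" "integrable F f" "integrable H f" "0 \<le> \<tau>" "\<tau> \<le> 1"
  shows "(LINT w|mixture F H \<tau>. f w) = (1 - \<tau>) *\<^sub>R (LINT w|F. f w) + \<tau> *\<^sub>R (LINT w|H. f w)"
proof (rule euclidean_eqI)
  fix b :: 'v
  assume "b \<in> Basis"
  show "(LINT w|mixture F H \<tau>. f w) \<bullet> b
      = ((1 - \<tau>) *\<^sub>R (LINT w|F. f w) + \<tau> *\<^sub>R (LINT w|H. f w)) \<bullet> b"
    using integral_mixture_real [of H F "\<lambda>w. f w \<bullet> b" \<tau>] assms integrable_mixture [of H F f \<tau>]
    by (simp add: inner_add_left)
qed

text \<open>The balance rearranges to
  \<open>P \<tau> = \<tau> *\<^sub>R (P \<tau> - Q \<tau>)\<close>, which turns continuity into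
  differentiability. The value \<open>P 0 = 0\<close> is a separate premise because the filter
  \<open>at_right 0\<close> excludes the point 0.\<close>

lemma has_vector_derivative_right_0_of_balance:
  fixes P Q :: "real \<Rightarrow> 'v::real_normed_vector"
  assumes balance: "\<forall>\<^sub>F \<tau> in at_right 0. (1 - \<tau>) *\<^sub>R P \<tau> + \<tau> *\<^sub>R Q \<tau> = 0"
    and "P 0 = 0" "continuous (at_right 0) P" "continuous (at_right 0) Q"
  shows "(P has_vector_derivative - Q 0) (at_right 0)"
proof -
  have "((\<lambda>\<tau>. P \<tau> - Q \<tau>) \<longlongrightarrow> - Q 0) (at_right 0)"
    using tendsto_diff [of P "P 0" "at_right 0" Q "Q 0"] assms by (simp add: continuous_within)
  then have "((\<lambda>\<tau>. P \<tau> - Q \<tau> - - Q 0) \<longlongrightarrow> 0) (at_right 0)"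
    by (simp only: LIM_zero_iff)
  \<comment> \<open>The right-hand side is left unsimplified: it is the normalised remainder that
    \<open>has_derivativeI\<close> requires to vanish, with candidate derivative
    \<open>- Q 0\<close>.\<close>
  moreover have "\<forall>\<^sub>F \<tau> in at_right 0.
      P \<tau> - Q \<tau> - - Q 0 = ((P \<tau> - P 0) - (\<tau> - 0) *\<^sub>R - Q 0) /\<^sub>R norm (\<tau> - 0)"
    using balance eventually_at_right_less
  proof eventually_elim
    case (elim \<tau>)
    then have "(P \<tau> - P 0) - (\<tau> - 0) *\<^sub>R - Q 0 = \<tau> *\<^sub>R (P \<tau> - Q \<tau> - - Q 0)"
      using \<open>P 0 = 0\<close> by (simp add: algebra_simps)
    with elim(2) show ?case
      by (simp only: scaleR_scaleR diff_zero real_norm_def abs_of_pos) simp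
  qed
  ultimately show ?thesis
    unfolding has_vector_derivative_def
    by (intro has_derivativeI bounded_linear_scaleR_left) (rule Lim_transform_eventually)
qed

theorem theorem1:
  fixes F\<^sub>0 H :: "'w measure"
    and g :: "'w \<Rightarrow> ('x \<Rightarrow> 'y) \<Rightarrow> real ^ 'p \<Rightarrow> real ^ 'm"
    and \<phi> :: "'w \<Rightarrow> ('x \<Rightarrow> 'y) \<Rightarrow> ('u \<Rightarrow> 'z) \<Rightarrow> real ^ 'p \<Rightarrow> real ^ 'm"
    and \<gamma> :: "'w measure \<Rightarrow> ('x \<Rightarrow> 'y)"
    and \<alpha> :: "'w measure \<Rightarrow> ('u \<Rightarrow> 'z)"
    and \<theta> :: "real ^ 'p"
    and F :: "real \<Rightarrow> 'w measure"
    and \<delta> \<tau>\<^sub>b :: real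
  defines "F \<equiv> mixture F\<^sub>0 H"
  assumes F0: "prob_space F\<^sub>0"
    and H: "prob_space H" "sets H = sets F\<^sub>0"
    and delta: "0 < \<delta>" "\<delta> \<le> 1"
    and integrable_g: "\<And>\<tau>. 0 \<le> \<tau> \<Longrightarrow> \<tau> < \<delta> \<Longrightarrow> integrable F\<^sub>0 (\<lambda>w. g w (\<gamma> (F \<tau>)) \<theta>)"
    and integrable_phi_F0:
      "\<And>\<tau>. 0 \<le> \<tau> \<Longrightarrow> \<tau> < \<delta> \<Longrightarrow> integrable F\<^sub>0 (\<lambda>w. \<phi> w (\<gamma> (F \<tau>)) (\<alpha> (F \<tau>)) \<theta>)"
    and integrable_phi_H:
      "\<And>\<tau>. 0 \<le> \<tau> \<Longrightarrow> \<tau> < \<delta> \<Longrightarrow> integrable H (\<lambda>w. \<phi> w (\<gamma> (F \<tau>)) (\<alpha> (F \<tau>)) \<theta>)"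
    and i_deriv: "((\<lambda>\<tau>. LINT w|F\<^sub>0. g w (\<gamma> (F \<tau>)) \<theta>) has_vector_derivative
        (LINT w|H. \<phi> w (\<gamma> F\<^sub>0) (\<alpha> F\<^sub>0) \<theta>)) (at_right 0)"
    and i_mean: "(LINT w|F\<^sub>0. \<phi> w (\<gamma> F\<^sub>0) (\<alpha> F\<^sub>0) \<theta>) = 0"
    and taub: "0 < \<tau>\<^sub>b" "\<tau>\<^sub>b \<le> 1"
    and ii: "\<And>\<tau>. 0 \<le> \<tau> \<Longrightarrow> \<tau> < \<tau>\<^sub>b \<Longrightarrow> (LINT w|F \<tau>. \<phi> w (\<gamma> (F \<tau>)) (\<alpha> (F \<tau>)) \<theta>) = 0"
    and iii_F0: "continuous (at_right 0) (\<lambda>\<tau>. LINT w|F\<^sub>0. \<phi> w (\<gamma> (F \<tau>)) (\<alpha> (F \<tau>)) \<theta>)"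
    and iii_H: "continuous (at_right 0) (\<lambda>\<tau>. LINT w|H. \<phi> w (\<gamma> (F \<tau>)) (\<alpha> (F \<tau>)) \<theta>)"
  shows "(\<lambda>\<tau>. LINT w|F\<^sub>0. \<phi> w (\<gamma> (F \<tau>)) (\<alpha> (F \<tau>)) \<theta>) differentiable (at_right 0)
    \<and> (\<lambda>\<tau>. psi_bar F\<^sub>0 g \<phi> (\<gamma> (F \<tau>)) (\<alpha> (F \<tau>)) \<theta>) differentiable (at_right 0)
    \<and> 0 = (LINT w|H. \<phi> w (\<gamma> F\<^sub>0) (\<alpha> F\<^sub>0) \<theta>)
          + right_deriv_0 (\<lambda>\<tau>. LINT w|F\<^sub>0. \<phi> w (\<gamma> (F \<tau>)) (\<alpha> (F \<tau>)) \<theta>)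
    \<and> (LINT w|H. \<phi> w (\<gamma> F\<^sub>0) (\<alpha> F\<^sub>0) \<theta>)
          + right_deriv_0 (\<lambda>\<tau>. LINT w|F\<^sub>0. \<phi> w (\<gamma> (F \<tau>)) (\<alpha> (F \<tau>)) \<theta>)
        = right_deriv_0 (\<lambda>\<tau>. LINT w|F\<^sub>0. g w (\<gamma> (F \<tau>)) \<theta>)
          + right_deriv_0 (\<lambda>\<tau>. LINT w|F\<^sub>0. \<phi> w (\<gamma> (F \<tau>)) (\<alpha> (F \<tau>)) \<theta>)
    \<and> right_deriv_0 (\<lambda>\<tau>. LINT w|F\<^sub>0. g w (\<gamma> (F \<tau>)) \<theta>)
          + right_deriv_0 (\<lambda>\<tau>. LINT w|F\<^sub>0. \<phi> w (\<gamma> (F \<tau>)) (\<alpha> (F \<tau>)) \<theta>)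
        = right_deriv_0 (\<lambda>\<tau>. psi_bar F\<^sub>0 g \<phi> (\<gamma> (F \<tau>)) (\<alpha> (F \<tau>)) \<theta>)"
proof -
  define P Q G where "P \<tau> = (LINT w|F\<^sub>0. \<phi> w (\<gamma> (F \<tau>)) (\<alpha> (F \<tau>)) \<theta>)"
    and "Q \<tau> = (LINT w|H. \<phi> w (\<gamma> (F \<tau>)) (\<alpha> (F \<tau>)) \<theta>)"
    and "G \<tau> = (LINT w|F\<^sub>0. g w (\<gamma> (F \<tau>)) \<theta>)" for \<tau>
  let ?\<Psi> = "\<lambda>\<tau>. psi_bar F\<^sub>0 g \<phi> (\<gamma> (F \<tau>)) (\<alpha> (F \<tau>)) \<theta>"
  \<comment> \<open>This identifies the quantities at \<open>\<gamma> F\<^sub>0\<close> and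
    \<open>\<alpha> F\<^sub>0\<close> in (i) with the values of the paths at \<tau> = 0.\<close>
  have F_0: "F 0 = F\<^sub>0"
    unfolding F_def using H(2) by (rule mixture_0)
  have P0: "P 0 = 0"
    using i_mean by (simp add: P_def F_0)
  have Q0: "(LINT w|H. \<phi> w (\<gamma> F\<^sub>0) (\<alpha> F\<^sub>0) \<theta>) = Q 0"
    by (simp add: Q_def F_0)
  \<comment> \<open>Below \<delta> the integrals exist, and below \<open>\<tau>\<^sub>b\<close>
    condition (ii) holds; \<open>\<tau>\<^sub>b \<le> 1\<close> also keeps the mixture weights
    nonnegative.\<close>
  have "\<forall>\<^sub>F \<tau> in at_right 0. 0 < \<tau> \<and> \<tau> < \<delta> \<and> \<tau> < \<tau>\<^sub>b"
    using delta(1) taub(1) by (auto simp: eventually_at_right intro!: exI [of _ "min \<delta> \<tau>\<^sub>b"])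
  then have "\<forall>\<^sub>F \<tau> in at_right 0. (1 - \<tau>) *\<^sub>R P \<tau> + \<tau> *\<^sub>R Q \<tau> = 0"
  proof eventually_elim
    case (elim \<tau>)
    then have "(1 - \<tau>) *\<^sub>R P \<tau> + \<tau> *\<^sub>R Q \<tau> = (LINT w|F \<tau>. \<phi> w (\<gamma> (F \<tau>)) (\<alpha> (F \<tau>)) \<theta>)"
      unfolding P_def Q_def
      using integral_mixture [OF H(2) integrable_phi_F0 [of \<tau>] integrable_phi_H [of \<tau>], of \<tau>] taub(2)
      by (simp add: F_def)
    also have "\<dots> = 0"
      using ii elim by simp
    finally show ?case .
  qed
  then have P': "(P has_vector_derivative - Q 0) (at_right 0)"
    by (rule has_vector_derivative_right_0_of_balance)
      (use P0 iii_F0 iii_H in \<open>simp_all add: P_def [abs_def] Q_def [abs_def]\<close>)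
  have G': "(G has_vector_derivative Q 0) (at_right 0)"
    using i_deriv by (simp add: G_def [abs_def] Q0)
  have \<Psi>: "?\<Psi> \<tau> = G \<tau> + P \<tau>" if "0 \<le> \<tau>" "\<tau> < \<delta>" for \<tau>
    using integrable_g [OF that] integrable_phi_F0 [OF that]
    by (simp add: psi_bar_def psi_def G_def P_def)
  \<comment> \<open>The derivatives \<open>Q 0\<close> of \<open>G\<close> and \<open>- Q 0\<close>
    of \<open>P\<close> cancel. The passage to \<open>{0..}\<close> is made because the
    transformation rule wants the base point inside the set.\<close>
  have \<Psi>': "(?\<Psi> has_vector_derivative 0) (at_right 0)"
    unfolding at_within_Ici_at_right [symmetric]
  proof (rule has_vector_derivative_transform_within)
    show "((\<lambda>\<tau>. G \<tau> + P \<tau>) has_vector_derivative 0) (at 0 within {0..})"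
      using has_vector_derivative_add [OF G' P'] by (simp add: at_within_Ici_at_right)
    show "G \<tau> + P \<tau> = ?\<Psi> \<tau>" if "\<tau> \<in> {0..}" "dist \<tau> 0 < \<delta>" for \<tau>
      using \<Psi> [of \<tau>] that by (simp add: dist_real_def)
  qed (use delta(1) in simp_all)
  \<comment> \<open>\<open>vector_derivative\<close> is a choice operator; the choice is forced
    because \<open>at_right 0\<close> is a nontrivial filter, so limits along it are unique.\<close>
  have unique: "right_deriv_0 f = D" if "(f has_vector_derivative D) (at_right 0)"
    for f :: "real \<Rightarrow> real ^ 'm" and D
    using that by (intro vector_derivative_within) simp_all
  have "P differentiable at_right 0" "?\<Psi> differentiable at_right 0"
    using P' \<Psi>' by (simp_all add: differentiableI_vector)
  \<comment> \<open>With the derivatives \<open>- Q 0\<close>, \<open>Q 0\<close> and 0 inserted,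
    every expression in the chain equals \<open>Q 0 - Q 0 = 0\<close>.\<close>
  with unique [OF P'] unique [OF G'] unique [OF \<Psi>'] show ?thesis
    by (simp add: Q0 P_def [abs_def] G_def [abs_def])
qed

end
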